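(* For all integers $n\ge 0$, $$\overline{SOME}(n)=2\sum_{k=0}^n \overline{p}(k)\,\sigma_{o-e}(n-k).$$
   Context: An overpartition of a nonnegative integer $n$ is a partition of $n$ in which the first occurrence of each distinct part may be overlined (or not). $\overline{p}(n)$ is the number of overpartitions of $n$, with $\overline{p}(0)=1$. For $n\ge 0$, $\overline{SOME}(n)$ denotes the sum, over all overpartitions $\lambda$ of $n$, of (the sum of the odd parts of $\lambda$) minus (the sum of the even parts of $\lambda$), where parts are counted with multiplicity and an overlined part counts with its numerical size; thus $\overline{SOME}(0)=0$. For a positive integer $a$, $\sigma_{o-e}(a)$ denotes the sum of the odd positive divisors $d$ of $a$ for which $a/d$ is odd, minus the sum of the even positive divisors $d$ of $a$ for which $a/d$ is odd; by convention $\sigma_{o-e}(0)=0$. *)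

theory Defs
  imports Complex_Main "HOL-Library.Multiset"
begin

text \<open>
  A partition of \<open>n\<close> is the multiset \<open>M\<close> of its (positive) parts. As only the first occurrence of
  each distinct part may be overlined, the overlining is determined by the set \<open>S\<close> of those part
  sizes whose first occurrence is overlined.
\<close>

definition overpartitions :: "nat \<Rightarrow> (nat multiset \<times> nat set) set" where
  "overpartitions n = {(M, S). 0 \<notin># M \<and> sum_mset M = n \<and> S \<subseteq> set_mset M}"

lemma finite_overpartitions: "finite (overpartitions n)"
proof -
  let ?L = "{xs. set xs \<subseteq> {..n} \<and> length xs \<le> n}"
  have size_le: "size M \<le> sum_mset M" if "0 \<notin># M" for M :: "nat multiset"
    using that by (induction M) auto
  have "overpartitions n \<subseteq> mset ` ?L \<times> Pow {..n}"
  proof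
    fix p assume "p \<in> overpartitions n"
    then obtain M S where p: "p = (M, S)" "0 \<notin># M" "sum_mset M = n" "S \<subseteq> set_mset M"
      by (auto simp: overpartitions_def)
    have le: "set_mset M \<subseteq> {..n}"
      using p(3) by (auto dest!: multi_member_split)
    obtain xs where xs: "M = mset xs" by (metis ex_mset)
    have "xs \<in> ?L" using size_le[OF p(2)] p(3) le unfolding xs by auto
    then show "p \<in> mset ` ?L \<times> Pow {..n}"
      using p xs le by auto
  qed
  moreover have "finite (mset ` ?L \<times> Pow {..n})"
    by (intro finite_cartesian_product finite_imageI finite_lists_length_le) auto
  ultimately show ?thesis by (rule finite_subset)
qed

definition pbar :: "nat \<Rightarrow> nat" where
  "pbar n = card (overpartitions n)"

lemma pbar_0: "pbar 0 = 1"
proof -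
  have "M = {#}" if "0 \<notin># M" "sum_mset M = 0" for M :: "nat multiset"
    using that by (cases M) auto
  then have "overpartitions 0 = {({#}, {})}"
    by (auto simp: overpartitions_def)
  then show ?thesis by (simp add: pbar_def)
qed

definition SOMEbar :: "nat \<Rightarrow> int" where
  "SOMEbar n = (\<Sum>(M, S)\<in>overpartitions n.
     int (\<Sum>x\<in>#filter_mset odd M. x) - int (\<Sum>x\<in>#filter_mset even M. x))"

definition sigma_oe :: "nat \<Rightarrow> int" where
  "sigma_oe a = (if a = 0 then 0 else
     int (\<Sum>d | d dvd a \<and> odd d \<and> odd (a div d). d)
   - int (\<Sum>d | d dvd a \<and> even d \<and> odd (a div d). d))"

end

theory Submission
  imports Defs
begin

text \<open>
  Write \<open>s d = d\<close> for odd \<open>d\<close> and \<open>s d = - d\<close> for even \<open>d\<close>. The left-hand side is the sum over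
  part sizes \<open>d\<close> of \<open>s d\<close> times the total multiplicity of \<open>d\<close> in all overpartitions of \<open>n\<close>, so
  it is enough to understand that total for one \<open>d\<close>. In generating functions, with \<open>x = q ^ d\<close>,
  the size \<open>d\<close> contributes the factor \<open>(1 + x) / (1 - x)\<close> to the product for overpartitions;
  counting multiplicities replaces that factor by \<open>2 x / (1 - x)\<^sup>2\<close>, and the quotient of the two is
  \<open>2 x / (1 - x\<^sup>2)\<close>, that is, twice the sum of the odd powers of \<open>x\<close>. Hence the total multiplicity
  of \<open>d\<close> is twice the sum of \<open>pbar (n - j * d)\<close> over odd \<open>j\<close>. Regrouping the pairs \<open>(d, j)\<close> by
  their product \<open>k = j * d\<close> turns the weights \<open>s d\<close> into \<open>sigma_oe k\<close>.

  The formula for the total multiplicity is proved here bijectively. If \<open>c j\<close> counts the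
  overpartitions of \<open>n\<close> with at least \<open>j\<close> parts equal to \<open>d\<close>, the total is \<open>c 1 + c 2 + \<dots>\<close>, and
  consecutive terms combine to \<open>c j + c (j + 1) = 2 * pbar (n - j * d)\<close>
  (\<open>card_overpartitions_with_add\<close>).
\<close>

definition overpartitions_with :: "nat \<Rightarrow> nat \<Rightarrow> nat \<Rightarrow> (nat multiset \<times> nat set) set" where
  "overpartitions_with n d j = {(M, S) \<in> overpartitions n. j \<le> count M d}"

lemma finite_overpartitions_with: "finite (overpartitions_with n d j)"
  by (rule finite_subset[OF _ finite_overpartitions[of n]]) (auto simp: overpartitions_with_def)

lemma count_mult_le_sum_mset: "count M d * d \<le> sum_mset M" for M :: "nat multiset"
proof (induction M)
  case (add x M)
  then show ?case by (cases "x = d") auto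
qed simp

lemma sum_mset_replicate_mset_nat: "sum_mset (replicate_mset j d) = j * d" for d :: nat
  by (induction j) auto

lemma card_overlined_eq_card_not_overlined:
  assumes "0 < j"
  shows "card {(M, S) \<in> overpartitions_with n d j. d \<in> S}
       = card {(M, S) \<in> overpartitions_with n d j. d \<notin> S}"
proof (rule bij_betw_same_card)
  have "d \<in># M" if "j \<le> count M d" for M
    using that assms by (metis count_greater_zero_iff less_le_trans)
  then show "bij_betw (\<lambda>(M, S). (M, S - {d}))
      {(M, S) \<in> overpartitions_with n d j. d \<in> S} {(M, S) \<in> overpartitions_with n d j. d \<notin> S}"
    by (intro bij_betw_byWitness[where f' = "\<lambda>(M, S). (M, insert d S)"])
       (auto simp: overpartitions_with_def overpartitions_def)
qed

text \<open>
  Deleting \<open>j\<close> copies of \<open>d\<close> from an overpartition leaves an overpartition as long as no overline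
  is lost, which is automatic if \<open>d\<close> is not overlined, and which otherwise requires an additional
  copy of \<open>d\<close>. This is why the two cases involve the thresholds \<open>j\<close> and \<open>j + 1\<close>.
\<close>

lemma card_not_overlined_remove:
  assumes "0 < d" "j * d \<le> n"
  shows "card {(M, S) \<in> overpartitions_with n d j. d \<notin> S}
       = card {(M, S) \<in> overpartitions (n - j * d). d \<notin> S}"
proof (rule bij_betw_same_card)
  have *: "\<exists>N. M = N + replicate_mset j d" if "j \<le> count M d" for M
    using that by (metis count_le_replicate_mset_subset_eq subset_mset.diff_add)
  show "bij_betw (\<lambda>(M, S). (M - replicate_mset j d, S))
      {(M, S) \<in> overpartitions_with n d j. d \<notin> S} {(M, S) \<in> overpartitions (n - j * d). d \<notin> S}"
    using assms
    by (intro bij_betw_byWitness[where f' = "\<lambda>(M, S). (M + replicate_mset j d, S)"])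
       (auto simp: overpartitions_with_def overpartitions_def sum_mset_replicate_mset_nat
         split: if_splits dest!: *)
qed

lemma card_overlined_remove:
  assumes "0 < d" "j * d \<le> n"
  shows "card {(M, S) \<in> overpartitions_with n d (Suc j). d \<in> S}
       = card {(M, S) \<in> overpartitions (n - j * d). d \<in> S}"
proof (rule bij_betw_same_card)
  have *: "\<exists>N. M = N + replicate_mset j d \<and> d \<in># N" if "Suc j \<le> count M d" for M
  proof -
    obtain N where N: "M = N + replicate_mset j d"
      using \<open>Suc j \<le> count M d\<close>
      by (metis Suc_leD count_le_replicate_mset_subset_eq subset_mset.diff_add)
    with that have "d \<in># N" by (simp flip: count_greater_zero_iff)
    with N show ?thesis by blast
  qed
  show "bij_betw (\<lambda>(M, S). (M - replicate_mset j d, S))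
      {(M, S) \<in> overpartitions_with n d (Suc j). d \<in> S} {(M, S) \<in> overpartitions (n - j * d). d \<in> S}"
    using assms
    by (intro bij_betw_byWitness[where f' = "\<lambda>(M, S). (M + replicate_mset j d, S)"])
       (auto simp: overpartitions_with_def overpartitions_def sum_mset_replicate_mset_nat Suc_le_eq
         split: if_splits dest!: *[unfolded Suc_le_eq])
qed

lemma overpartitions_with_empty:
  assumes "n < j * d"
  shows "overpartitions_with n d j = {}"
proof -
  have False if "j \<le> count M d" "sum_mset M = n" for M
    using count_mult_le_sum_mset[of M d] mult_le_mono1[OF that(1), of d] that(2) assms by linarith
  then show ?thesis by (auto simp: overpartitions_with_def overpartitions_def)
qed

lemma card_split_overlined:
  assumes "finite A"
  shows "card A = card {(M, S) \<in> A. d \<in> S} + card {(M, S) \<in> A. d \<notin> S}"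
proof -
  have "A = {(M, S) \<in> A. d \<in> S} \<union> {(M, S) \<in> A. d \<notin> S}" by auto
  moreover have "finite {(M, S) \<in> A. d \<in> S}" "finite {(M, S) \<in> A. d \<notin> S}"
    by (rule finite_subset[OF _ assms]; auto)+
  ultimately show ?thesis by (metis (no_types, lifting) card_Un_disjoint disjoint_iff
      case_prod_unfold mem_Collect_eq)
qed

text \<open>
  When \<open>d\<close> occurs, its overline can be switched on and off, so \<open>c j\<close> is twice the count with \<open>d\<close>
  not overlined, and \<open>c (j + 1)\<close> is twice the count with \<open>d\<close> overlined. Deleting \<open>j\<close> copies of
  \<open>d\<close> maps these two halves onto the overpartitions of \<open>n - j * d\<close> without and with an overlined
  \<open>d\<close>, respectively, and together these are all of them.
\<close>

lemma card_overpartitions_with_add: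
  assumes "0 < d" "0 < j"
  shows "card (overpartitions_with n d j) + card (overpartitions_with n d (Suc j))
       = (if j * d \<le> n then 2 * pbar (n - j * d) else 0)"
proof (cases "j * d \<le> n")
  case True
  have "card (overpartitions_with n d j)
      = 2 * card {(M, S) \<in> overpartitions (n - j * d). d \<notin> S}"
    using card_split_overlined[OF finite_overpartitions_with, of n d j d]
      card_overlined_eq_card_not_overlined[OF assms(2), of n d]
      card_not_overlined_remove[OF assms(1) True] by linarith
  moreover have "card (overpartitions_with n d (Suc j))
      = 2 * card {(M, S) \<in> overpartitions (n - j * d). d \<in> S}"
    using card_split_overlined[OF finite_overpartitions_with, of n d "Suc j" d]
      card_overlined_eq_card_not_overlined[of "Suc j" n d]
      card_overlined_remove[OF assms(1) True] by linarith
  ultimately show ?thesis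
    using True card_split_overlined[OF finite_overpartitions, of "n - j * d" d]
    by (simp add: pbar_def)
next
  case False
  then show ?thesis by (simp add: overpartitions_with_empty)
qed

text \<open>
  For odd \<open>n\<close> the last pair reaches past \<open>n\<close>; the extra term vanishes in the application, since
  no part of an overpartition of \<open>n\<close> occurs \<open>n + 1\<close> times.
\<close>

lemma sum_pair_odd:
  fixes c :: "nat \<Rightarrow> nat"
  shows "(\<Sum>j | j \<in> {1..n} \<and> odd j. c j + c (Suc j))
       = (\<Sum>j = 1..n. c j) + (if odd n then c (Suc n) else 0)"
proof (induction n)
  case (Suc n)
  have "{j. j \<in> {1..Suc n} \<and> odd j} =
      (if even n then insert (Suc n) {j. j \<in> {1..n} \<and> odd j} else {j. j \<in> {1..n} \<and> odd j})"
    by (auto simp: le_Suc_eq)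
  with Suc show ?case by simp
qed simp

lemma sum_count_overpartitions:
  assumes "0 < d"
  shows "(\<Sum>(M, S)\<in>overpartitions n. count M d)
       = 2 * (\<Sum>j | j \<in> {1..n} \<and> odd j \<and> j * d \<le> n. pbar (n - j * d))"
proof -
  let ?c = "\<lambda>j. card (overpartitions_with n d j)"
  have "count M d = (\<Sum>j = 1..n. if j \<le> count M d then 1 else 0)"
    if "(M, S) \<in> overpartitions n" for M S
  proof -
    have "count M d \<le> count M d * d" using assms by simp
    also have "\<dots> \<le> n" using that count_mult_le_sum_mset[of M d] by (simp add: overpartitions_def)
    finally have "{1..n} \<inter> {j. j \<le> count M d} = {1..count M d}" by auto
    then show ?thesis by (simp add: sum.If_cases)
  qed
  then have "(\<Sum>(M, S)\<in>overpartitions n. count M d)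
      = (\<Sum>(M, S)\<in>overpartitions n. \<Sum>j = 1..n. if j \<le> count M d then 1 else 0)"
    by (intro sum.cong) auto
  also have "\<dots> = (\<Sum>j = 1..n. \<Sum>(M, S)\<in>overpartitions n. if j \<le> count M d then 1 else 0)"
    unfolding case_prod_unfold by (rule sum.swap)
  also have "\<dots> = (\<Sum>j = 1..n. ?c j)"
  proof (rule sum.cong[OF refl])
    fix j
    have "overpartitions_with n d j = overpartitions n \<inter> {p. j \<le> count (fst p) d}"
      by (auto simp: overpartitions_with_def)
    then show "(\<Sum>(M, S)\<in>overpartitions n. if j \<le> count M d then 1 else 0) = ?c j"
      by (simp add: case_prod_unfold sum.If_cases finite_overpartitions)
  qed
  also have "\<dots> = (\<Sum>j | j \<in> {1..n} \<and> odd j. ?c j + ?c (Suc j))"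
  proof -
    have "n < Suc n * d" using assms by (cases d) auto
    then have "?c (Suc n) = 0" by (simp only: overpartitions_with_empty card.empty)
    then show ?thesis using sum_pair_odd[of ?c n] by simp
  qed
  also have "\<dots> = (\<Sum>j | j \<in> {1..n} \<and> odd j. if j * d \<le> n then 2 * pbar (n - j * d) else 0)"
    by (intro sum.cong refl card_overpartitions_with_add assms) auto
  also have "\<dots> = (\<Sum>j | j \<in> {1..n} \<and> odd j \<and> j * d \<le> n. 2 * pbar (n - j * d))"
    by (rule sum.mono_neutral_cong_right) auto
  finally show ?thesis by (simp add: sum_distrib_left)
qed

definition signed_part :: "nat \<Rightarrow> int" where
  "signed_part d = (if odd d then int d else - int d)"

lemma sigma_oe_eq:
  assumes "0 < a"
  shows "sigma_oe a = (\<Sum>d | d dvd a \<and> odd (a div d). signed_part d)"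
proof -
  let ?D = "{d. d dvd a \<and> odd (a div d)}"
  have fin: "finite ?D" by (rule finite_subset[of _ "{..a}"]) (use assms in \<open>auto dest: dvd_imp_le\<close>)
  have "?D \<inter> {d. odd d} = {d. d dvd a \<and> odd d \<and> odd (a div d)}"
    "?D \<inter> - {d. odd d} = {d. d dvd a \<and> even d \<and> odd (a div d)}" by auto
  then show ?thesis
    using assms fin by (simp add: sigma_oe_def signed_part_def sum.If_cases sum_negf)
qed

lemma odd_minus_even_parts:
  assumes "(M, S) \<in> overpartitions n"
  shows "int (\<Sum>x\<in>#filter_mset odd M. x) - int (\<Sum>x\<in>#filter_mset even M. x)
       = (\<Sum>d = 1..n. signed_part d * int (count M d))"
proof -
  have "int (\<Sum>x\<in>#filter_mset odd N. x) - int (\<Sum>x\<in>#filter_mset even N. x)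
      = (\<Sum>d = 1..n. signed_part d * int (count N d))" if "set_mset N \<subseteq> {1..n}" for N
    using that
  proof (induction N)
    case (add x N)
    have "(\<Sum>d = 1..n. signed_part d * int (count (add_mset x N) d))
        = (\<Sum>d = 1..n. signed_part d * int (count N d) + (if d = x then signed_part d else 0))"
      by (intro sum.cong) (auto simp: algebra_simps)
    also have "\<dots> = (\<Sum>d = 1..n. signed_part d * int (count N d)) + signed_part x"
      using add.prems by (simp add: sum.distrib)
    finally show ?case using add by (auto simp: signed_part_def)
  qed simp
  moreover have "set_mset M \<subseteq> {1..n}"
  proof
    fix x assume "x \<in># M"
    with assms show "x \<in> {1..n}"
      by (auto simp: overpartitions_def Suc_le_eq dest!: multi_member_split)
  qed
  ultimately show ?thesis by blast
qed

theorem theorem4: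
  fixes n :: nat
  shows "SOMEbar n = 2 * (\<Sum>k=0..n. int (pbar k) * sigma_oe (n - k))"
proof -
  \<comment> \<open>Pairs \<open>(d, j)\<close> with \<open>j\<close> odd are pairs of a number \<open>k\<close> and a divisor \<open>d\<close> of \<open>k\<close> with odd
    cofactor, so that exchanging the sums over \<open>d\<close> and \<open>k\<close> below produces \<open>sigma_oe k\<close>.\<close>
  have reindex: "(\<Sum>j | j \<in> {1..n} \<and> odd j \<and> j * d \<le> n. int (pbar (n - j * d)))
      = (\<Sum>k | k \<in> {1..n} \<and> d dvd k \<and> odd (k div d). int (pbar (n - k)))" if "0 < d" for d
  proof (rule sum.reindex_bij_witness[of _ "\<lambda>k. k div d" "\<lambda>j. j * d"])
    fix k assume "k \<in> {k. k \<in> {1..n} \<and> d dvd k \<and> odd (k div d)}"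
    then obtain j where "k = d * j" "odd j" "1 \<le> k" "k \<le> n" using that by auto
    moreover have "j \<le> n" using calculation that by (cases d) auto
    ultimately show "k div d \<in> {j. j \<in> {1..n} \<and> odd j \<and> j * d \<le> n}"
      using that by (auto simp: mult.commute Suc_le_eq)
  qed (use that in \<open>auto simp: Suc_le_eq\<close>)
  have "SOMEbar n = (\<Sum>(M, S)\<in>overpartitions n. \<Sum>d = 1..n. signed_part d * int (count M d))"
    unfolding SOMEbar_def by (intro sum.cong) (auto simp only: case_prod_conv odd_minus_even_parts)
  also have "\<dots> = (\<Sum>d = 1..n. \<Sum>(M, S)\<in>overpartitions n. signed_part d * int (count M d))"
    unfolding case_prod_unfold by (rule sum.swap)
  also have "\<dots> = (\<Sum>d = 1..n. signed_part d * int (\<Sum>(M, S)\<in>overpartitions n. count M d))"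
    by (simp add: sum_distrib_left case_prod_unfold)
  also have "\<dots> = (\<Sum>d = 1..n. 2 * (\<Sum>k | k \<in> {1..n} \<and> d dvd k \<and> odd (k div d).
      signed_part d * int (pbar (n - k))))"
  proof (rule sum.cong[OF refl])
    fix d assume "d \<in> {1..n}"
    then have "0 < d" by simp
    then show "signed_part d * int (\<Sum>(M, S)\<in>overpartitions n. count M d)
      = 2 * (\<Sum>k | k \<in> {1..n} \<and> d dvd k \<and> odd (k div d). signed_part d * int (pbar (n - k)))"
      using reindex[of d] by (simp add: sum_count_overpartitions flip: sum_distrib_left)
  qed
  also have "\<dots> = 2 * (\<Sum>d = 1..n. \<Sum>k | k \<in> {1..n} \<and> d dvd k \<and> odd (k div d).
      signed_part d * int (pbar (n - k)))"
    by (simp only: sum_distrib_left)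
  also have "\<dots> = 2 * (\<Sum>k = 1..n. \<Sum>d | d \<in> {1..n} \<and> d dvd k \<and> odd (k div d).
      signed_part d * int (pbar (n - k)))"
    by (subst sum.swap_restrict) auto
  also have "\<dots> = 2 * (\<Sum>k = 1..n. int (pbar (n - k)) * sigma_oe k)"
  proof -
    have "(\<Sum>d | d \<in> {1..n} \<and> d dvd k \<and> odd (k div d). signed_part d * int (pbar (n - k)))
        = int (pbar (n - k)) * sigma_oe k" if "k \<in> {1..n}" for k
    proof -
      have "{d. d \<in> {1..n} \<and> d dvd k \<and> odd (k div d)} = {d. d dvd k \<and> odd (k div d)}"
        using that dvd_imp_le[of _ k] by (force simp: Suc_le_eq intro: Nat.gr0I)
      with that show ?thesis by (simp add: sigma_oe_eq sum_distrib_left mult.commute)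
    qed
    then show ?thesis by simp
  qed
  also have "\<dots> = 2 * (\<Sum>k = 0..n. int (pbar (n - k)) * sigma_oe k)"
    by (simp add: sum.atLeast_Suc_atMost[of 0 n] sigma_oe_def)
  also have "(\<Sum>k = 0..n. int (pbar (n - k)) * sigma_oe k)
      = (\<Sum>k = 0..n. int (pbar k) * sigma_oe (n - k))"
    by (rule sum.reindex_bij_witness[of _ "\<lambda>k. n - k" "\<lambda>k. n - k"]) auto
  finally show ?thesis .
qed

end
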